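(* Let $P(z)=\sum_{i=1}^k a_{m_i}z^{m_i}\in\mathbb{Z}[z]$ be a non-constant polynomial with positive integer exponents $m_1,\dots,m_k$, where $a_{m_i}\neq0$ for all $i\in[1,k]$ (so $P(0)=0$). Let $\Omega_P=P^{-1}(B(0,1))\cap B(0,1)$. Let $S\subseteq\Omega_P\cap\overline{\mathbb{Q}}$ be a set closed under complex conjugation, with $0\in S$, such that for every $\alpha\in S$ all complex roots of the polynomial $P(z)-P(\alpha)$ lie in $S$. Then there are uncountably many transcendental functions $\psi(z)$, analytic in $\Omega_P$ and with integer (Taylor) coefficients, such that \[ S_\psi=S\qquad\text{and}\qquad \underline{\delta}(L_0(\psi))\ge 1-\frac{1}{\gcd(m_1,\ldots,m_k)}, \] where by convention $\gcd(m_1,\ldots,m_k)=m_1$ when $k=1$.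
   Context: $B(0,1)$ is the open unit disc and $\overline{\mathbb{Q}}$ the set of algebraic numbers. The exceptional set of $\psi$ is $S_\psi=\{\alpha\in\overline{\mathbb{Q}}\cap\Omega_P:\psi(\alpha)\in\overline{\mathbb{Q}}\}$. For $\psi(z)=\sum_{n\ge0}b_nz^n$ (expansion at $0$), $L_0(\psi)=\{n\ge0:b_n=0\}$, and for $\mathcal{A}\subseteq\mathbb{Z}_{\ge0}$ the lower asymptotic density is $\underline{\delta}(\mathcal{A})=\liminf_{n\to\infty}\#(\mathcal{A}\cap[0,n])/n$. A function is transcendental if it is not algebraic over $\mathbb{C}(z)$. *)

theory Defs
  imports "HOL-Complex_Analysis.Complex_Analysis"
begin

abbreviation cpoly_of_int :: "int poly \<Rightarrow> complex poly" where
  "cpoly_of_int P \<equiv> map_poly of_int P"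

definition Omega :: "int poly \<Rightarrow> complex set" where
  "Omega P = poly (cpoly_of_int P) -` ball 0 1 \<inter> ball 0 1"

(* Q is a polynomial in w with coefficients in C[z], evaluated at w = f z.  Allowing
   coefficients in C(z) gives the same notion, by clearing denominators. *)
definition algebraic_function_on :: "complex set \<Rightarrow> (complex \<Rightarrow> complex) \<Rightarrow> bool" where
  "algebraic_function_on U f \<longleftrightarrow>
     (\<exists>Q :: complex poly poly. Q \<noteq> 0 \<and> (\<forall>z\<in>U. poly (poly Q [:f z:]) z = 0))"

definition transcendental_function_on :: "complex set \<Rightarrow> (complex \<Rightarrow> complex) \<Rightarrow> bool" where
  "transcendental_function_on U f \<longleftrightarrow> \<not> algebraic_function_on U f"

definition exceptional_set :: "complex set \<Rightarrow> (complex \<Rightarrow> complex) \<Rightarrow> complex set" where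
  "exceptional_set U f = {\<alpha>. algebraic \<alpha> \<and> \<alpha> \<in> U \<and> algebraic (f \<alpha>)}"

definition taylor_coeff :: "(complex \<Rightarrow> complex) \<Rightarrow> nat \<Rightarrow> complex" where
  "taylor_coeff f n = fps_nth (fps_expansion f 0) n"

definition zero_coeffs :: "(complex \<Rightarrow> complex) \<Rightarrow> nat set" where
  "zero_coeffs f = {n. taylor_coeff f n = 0}"

definition lower_density :: "nat set \<Rightarrow> ereal" where
  "lower_density A = liminf (\<lambda>n. ereal (real (card (A \<inter> {0..n})) / real n))"

end

theory Submission
  imports Defs
begin

text \<open>
  Take \<open>\<psi> = f \<circ> P\<close>, where \<open>f\<close> is an integer power series converging on the unit disc whose value at a
  point \<open>P \<alpha>\<close> (\<open>\<alpha>\<close> algebraic in \<open>\<Omega>\<^sub>P\<close>) is algebraic precisely when \<open>P \<alpha> \<in> P S\<close>; the root condition on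
  \<open>S\<close> says that \<open>P \<alpha> \<in> P S\<close> means \<open>\<alpha> \<in> S\<close>. The Taylor coefficients of \<open>\<psi>\<close> live in degrees divisible by
  the gcd of the exponents, which gives the density bound.

  Enumerate the relevant points of the closed upper half disc as \<open>\<alpha>\<^sub>0, \<alpha>\<^sub>1, \<dots>\<close> and let
  \<open>Q\<^sub>n = \<Prod>\<^sub>j\<^sub><\<^sub>n (1 - z / \<alpha>\<^sub>j) (1 - z / cnj \<alpha>\<^sub>j)\<close>, a real polynomial with constant term 1. The series \<open>f\<close>
  is a sum of terms \<open>z\<^sup>k r\<^sub>k\<close>, where \<open>r\<^sub>k = (s + t z) Q\<^sub>n + c Q\<^sub>n'\<close> with bounded real \<open>s\<close>, \<open>t\<close>, \<open>c\<close> and \<open>n'\<close> is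
  \<open>n\<close> or \<open>n + 1\<close>. This does not change the values at \<open>\<alpha>\<^sub>j\<close> for \<open>j < n\<close>; the number \<open>c\<close> makes the \<open>k\<close>-th
  coefficient an integer, and if \<open>n' = n + 1\<close>, the numbers \<open>s\<close> and \<open>t\<close> move the value at \<open>\<alpha>\<^sub>n\<close> into or
  out of the algebraic numbers. If \<open>n\<close> grows slowly with \<open>k\<close>, the series converges on the
  disc. Each integer coefficient can moreover avoid one prescribed value, so by diagonalisation there
  are uncountably many such \<open>f\<close>.

  Only countably many integer power series are algebraic over \<open>\<complex>(z)\<close>: an additive functional
  \<open>\<complex> \<rightarrow> \<rat>\<close> applied to the coefficients of a polynomial relation yields a rational one.
\<close>

subsection \<open>Algebraic power series with integer coefficients\<close>

lemma countable_poly_coeffs: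
  assumes "countable C"
  shows "countable {p. \<forall>i. coeff p i \<in> C}"
proof -
  have "{p. \<forall>i. coeff p i \<in> C} \<subseteq> Poly ` lists C"
  proof
    fix p assume p: "p \<in> {p. \<forall>i. coeff p i \<in> C}"
    have "set (coeffs p) \<subseteq> range (coeff p)"
      by (simp add: range_coeff subset_insertI)
    with p have "set (coeffs p) \<subseteq> C"
      by auto
    then show "p \<in> Poly ` lists C"
      by (intro image_eqI[of _ _ "coeffs p"]) (auto simp: lists_eq_set)
  qed
  then show ?thesis
    by (rule countable_subset) (use assms in simp)
qed

lemma countable_algebraic_complex: "countable {x::complex. algebraic x}"
proof -
  have "countable (\<Union>p\<in>{p::complex poly. \<forall>i. coeff p i \<in> \<int>} - {0}. {x. poly p x = 0})"
  proof (rule countable_UN)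
    have "countable (\<int> :: complex set)"
      by (simp add: Ints_def)
    then show "countable ({p::complex poly. \<forall>i. coeff p i \<in> \<int>} - {0})"
      using countable_poly_coeffs by blast
  qed (auto intro: countable_finite poly_roots_finite)
  moreover have "{x::complex. algebraic x} \<subseteq> (\<Union>p\<in>{p::complex poly. \<forall>i. coeff p i \<in> \<int>} - {0}. {x. poly p x = 0})"
    by (auto simp: algebraic_def)
  ultimately show ?thesis
    using countable_subset by blast
qed

text \<open>Regard the complex numbers as a vector space over the rationals, extend
  \<open>{c}\<close> to a basis and take the coordinate along \<open>c\<close>. Its values are
  embedded in \<open>complex\<close> so that it can act on the coefficients of complex
  polynomials.\<close>

lemma additive_rational_functional_exists:
  fixes c :: complex
  assumes "c \<noteq> 0"
  shows "\<exists>\<phi> :: complex \<Rightarrow> complex. (\<forall>x y. \<phi> (x + y) = \<phi> x + \<phi> y) \<and> (\<forall>x. \<phi> x \<in> \<rat>) \<and> \<phi> c \<noteq> 0"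
proof -
  interpret V: vector_space "\<lambda>(q::rat) (x::complex). of_rat q * x"
    by unfold_locales (auto simp: of_rat_add of_rat_mult algebra_simps)
  let ?B = "V.extend_basis {c}"
  have ind: "V.independent {c}"
    using assms by simp
  note B = V.independent_extend_basis[OF ind]
  have c: "c \<in> ?B"
    using V.extend_basis_superset[OF ind] by blast
  define \<phi> :: "complex \<Rightarrow> complex" where "\<phi> = (\<lambda>x. of_rat (V.representation ?B x c))"
  show ?thesis
  proof (intro exI[of _ \<phi>] conjI allI)
    show "\<phi> (x + y) = \<phi> x + \<phi> y" for x y
      unfolding \<phi>_def using V.span_extend_basis[OF ind]
      by (subst V.representation_add[OF B]) (auto simp: of_rat_add)
    show "\<phi> x \<in> \<rat>" for x
      by (simp add: \<phi>_def)
    show "\<phi> c \<noteq> 0"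
      by (simp add: \<phi>_def V.representation_basis[OF B c])
  qed
qed

text \<open>Additivity alone gives linearity over the integers. This is what lets a functional pass
  through a relation satisfied by a series with integer coefficients.\<close>

lemma additive_mult_Ints:
  fixes \<phi> :: "complex \<Rightarrow> complex"
  assumes add: "\<And>x y. \<phi> (x + y) = \<phi> x + \<phi> y" and "k \<in> \<int>"
  shows "\<phi> (x * k) = \<phi> x * k"
proof -
  interpret additive \<phi> by unfold_locales (rule add)
  obtain i where i: "k = of_int i"
    using assms(2) by (elim Ints_cases)
  have nat: "\<phi> (x * of_nat n) = \<phi> x * of_nat n" for n
    by (induction n) (auto simp: zero add algebra_simps)
  show ?thesis
    by (cases i rule: int_cases2) (use nat in \<open>simp_all add: i minus\<close>)
qed

lemma fps_power_coeff_Ints: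
  fixes \<phi> :: "complex fps"
  assumes "\<And>n. fps_nth \<phi> n \<in> \<int>"
  shows "fps_nth (\<phi> ^ i) n \<in> \<int>"
proof (induction i arbitrary: n)
  case (Suc i)
  then show ?case
    using assms by (auto simp: fps_mult_nth intro!: Ints_sum Ints_mult)
qed auto

text \<open>Every such series already satisfies a nontrivial relation with rational coefficients.
  There are countably many of these, each with finitely many roots in the integral domain of power
  series.\<close>

lemma countable_algebraic_Ints_fps:
  "countable {\<phi> :: complex fps. (\<forall>n. fps_nth \<phi> n \<in> \<int>) \<and>
     (\<exists>Q :: complex poly poly. Q \<noteq> 0 \<and> poly (map_poly fps_of_poly Q) \<phi> = 0)}"
    (is "countable ?A")
proof -
  define R :: "complex poly poly set" where "R = {Q. \<forall>i. coeff Q i \<in> {p. \<forall>j. coeff p j \<in> \<rat>}} - {0}"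
  have "countable R"
    unfolding R_def by (intro countable_Diff countable_poly_coeffs countable_rat)
  moreover have "countable {\<phi> :: complex fps. poly (map_poly fps_of_poly Q) \<phi> = 0}" if "Q \<in> R" for Q
  proof (intro countable_finite poly_roots_finite)
    show "map_poly fps_of_poly Q \<noteq> 0"
      using that by (auto simp: R_def map_poly_eq_0_iff)
  qed
  ultimately have "countable (\<Union>Q\<in>R. {\<phi> :: complex fps. poly (map_poly fps_of_poly Q) \<phi> = 0})"
    by blast
  moreover have "?A \<subseteq> (\<Union>Q\<in>R. {\<phi> :: complex fps. poly (map_poly fps_of_poly Q) \<phi> = 0})"
  proof safe
    fix \<phi> :: "complex fps" and Q :: "complex poly poly"
    assume int: "\<forall>n. fps_nth \<phi> n \<in> \<int>" and Q: "Q \<noteq> 0" "poly (map_poly fps_of_poly Q) \<phi> = 0"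
    \<comment> \<open>The common range of summation serves both \<open>Q\<close> and its image
      \<open>Q'\<close> under the functional.\<close>
    have eval: "poly (map_poly fps_of_poly p) \<phi> = (\<Sum>i\<le>degree Q. fps_of_poly (coeff p i) * \<phi> ^ i)"
      if "degree p \<le> degree Q" for p :: "complex poly poly"
    proof -
      have "degree (map_poly fps_of_poly p) \<le> degree Q"
        using that by (intro degree_le) (auto simp: coeff_map_poly coeff_eq_0)
      then show ?thesis
        unfolding poly_altdef by (intro sum.mono_neutral_cong_left) (auto simp: coeff_map_poly intro!: le_degree)
    qed
    \<comment> \<open>Any nonzero coefficient would do: the functional is chosen not to kill it,
      which keeps \<open>Q'\<close> nonzero.\<close>
    let ?c = "coeff (coeff Q (degree Q)) (degree (coeff Q (degree Q)))"
    have "?c \<noteq> 0"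
      using Q by simp
    from additive_rational_functional_exists[OF this] obtain h :: "complex \<Rightarrow> complex"
      where "(\<forall>x y. h (x + y) = h x + h y) \<and> (\<forall>x. h x \<in> \<rat>) \<and> h ?c \<noteq> 0" ..
    then have h: "\<And>x y. h (x + y) = h x + h y" "\<And>x. h x \<in> \<rat>" "h ?c \<noteq> 0"
      by simp_all
    interpret h: additive h by unfold_locales (rule h(1))
    define Q' where "Q' = map_poly (map_poly h) Q"
    have coeff_Q': "coeff (coeff Q' i) j = h (coeff (coeff Q i) j)" for i j
      by (simp add: Q'_def coeff_map_poly h.zero)
    have "Q' \<noteq> 0"
      using h(3) coeff_Q'[of "degree Q" "degree (coeff Q (degree Q))"] by fastforce
    then have "Q' \<in> R"
      using h(2) by (simp add: R_def coeff_Q')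
    moreover have degree_Q': "degree Q' \<le> degree Q"
      by (rule degree_le) (simp add: Q'_def coeff_map_poly coeff_eq_0)
    have "poly (map_poly fps_of_poly Q') \<phi> = 0"
    proof (rule fps_ext)
      fix n
      have "fps_nth (poly (map_poly fps_of_poly Q') \<phi>) n =
          (\<Sum>i\<le>degree Q. \<Sum>j=0..n. h (coeff (coeff Q i) j) * fps_nth (\<phi> ^ i) (n - j))"
        by (simp add: eval[OF degree_Q'] fps_sum_nth fps_mult_nth coeff_Q')
      also have "\<dots> = h (\<Sum>i\<le>degree Q. \<Sum>j=0..n. coeff (coeff Q i) j * fps_nth (\<phi> ^ i) (n - j))"
        using int by (simp add: h.sum additive_mult_Ints[of h, OF h(1)] fps_power_coeff_Ints)
      also have "(\<Sum>i\<le>degree Q. \<Sum>j=0..n. coeff (coeff Q i) j * fps_nth (\<phi> ^ i) (n - j)) =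
          fps_nth (poly (map_poly fps_of_poly Q) \<phi>) n"
        by (simp add: eval[OF order.refl] fps_sum_nth fps_mult_nth)
      also have "\<dots> = 0"
        using Q by simp
      finally show "fps_nth (poly (map_poly fps_of_poly Q') \<phi>) n = fps_nth 0 n"
        by (simp add: h.zero)
    qed
    ultimately show "\<phi> \<in> (\<Union>Q\<in>R. {\<phi> :: complex fps. poly (map_poly fps_of_poly Q) \<phi> = 0})"
      by blast
  qed
  ultimately show ?thesis
    by (rule countable_subset[rotated])
qed

subsection \<open>Interpolation by integer power series\<close>

lemma algebraic_Complex_Rats:
  assumes "x \<in> \<rat>" "y \<in> \<rat>"
  shows "algebraic (Complex x y)"
proof (rule algebraicI')
  let ?p = "[:of_real (x\<^sup>2 + y\<^sup>2), of_real (- 2 * x), 1:] :: complex poly"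
  show "coeff ?p i \<in> \<rat>" for i
    using assms by (auto simp: coeff_pCons split: nat.splits elim!: Rats_cases intro!: Rats_add Rats_mult Rats_power)
  show "?p \<noteq> 0"
    by simp
  show "poly ?p (Complex x y) = 0"
    by (auto simp: complex_eq_iff algebra_simps power2_eq_square)
qed

text \<open>For non-real \<open>a\<close>, the numbers 1 and \<open>a\<close> span the plane over
  the reals, so the perturbations fill a neighbourhood of \<open>v\<close>, which contains a point
  with rational coordinates. For real \<open>a\<close> everything stays on the real line, and
  \<open>t = 0\<close> suffices to hit a rational.\<close>

lemma exists_perturbation_algebraic:
  fixes v w a :: complex
  assumes w: "w \<noteq> 0" and real: "a \<in> \<real> \<Longrightarrow> v \<in> \<real> \<and> w \<in> \<real>"
  obtains s t :: real where "\<bar>s\<bar> \<le> 1" "\<bar>t\<bar> \<le> 1" "algebraic (v + (of_real s + of_real t * a) * w)"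
proof (cases "a \<in> \<real>")
  case True
  then obtain v' w' where vw: "v = of_real v'" "w = of_real w'"
    using real by (auto elim!: Reals_cases)
  obtain q where q: "q \<in> \<rat>" "v' < q" "q < v' + \<bar>w'\<bar>"
    using Rats_dense_in_real[of v' "v' + \<bar>w'\<bar>"] w vw by auto
  show ?thesis
  proof
    show "\<bar>(q - v') / w'\<bar> \<le> 1"
      using q by (simp add: divide_le_eq)
    have "v + (of_real ((q - v') / w') + of_real 0 * a) * w = of_real q"
      using w vw by (simp flip: of_real_mult of_real_add)
    then show "algebraic (v + (of_real ((q - v') / w') + of_real 0 * a) * w)"
      using q(1) by (auto intro!: rat_imp_algebraic elim!: Rats_cases)
  qed simp
next
  case False
  define y where "y = \<bar>Im a\<bar>"
  have y: "y > 0"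
    using False by (simp add: y_def complex_is_Real_iff)
  \<comment> \<open>This radius ensures that any \<open>\<eta>\<close> of norm at most
    \<open>\<rho>\<close> has coordinates \<open>s\<close>, \<open>t\<close> of modulus at most 1:
    \<open>t * Re a\<close> and \<open>Re \<eta>\<close> each contribute at most 1/2 to
    \<open>s\<close>.\<close>
  define \<rho> where "\<rho> = min (1/2) (y / (2 * (1 + norm a)))"
  have \<rho>: "\<rho> > 0" "\<rho> \<le> 1/2" "\<rho> \<le> y / (2 * (1 + norm a))"
    using y unfolding \<rho>_def
    by (simp add: add_pos_nonneg, intro min.cobounded1, intro min.cobounded2)
  have "\<rho> * norm w / 2 > 0"
    using \<rho> w by simp
  then obtain q1 q2 where q: "q1 \<in> \<rat>" "q2 \<in> \<rat>" "Re v < q1" "q1 < Re v + \<rho> * norm w / 2"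
      "Im v < q2" "q2 < Im v + \<rho> * norm w / 2"
    using Rats_dense_in_real[of "Re v" "Re v + \<rho> * norm w / 2"]
      Rats_dense_in_real[of "Im v" "Im v + \<rho> * norm w / 2"] by auto
  define \<eta> where "\<eta> = (Complex q1 q2 - v) / w"
  have "norm (Complex q1 q2 - v) \<le> \<bar>q1 - Re v\<bar> + \<bar>q2 - Im v\<bar>"
    using cmod_le[of "Complex q1 q2 - v"] by simp
  also have "\<dots> \<le> \<rho> * norm w"
    using q by linarith
  finally have \<eta>: "norm \<eta> \<le> \<rho>"
    using w by (simp add: \<eta>_def norm_divide divide_le_eq)
  \<comment> \<open>\<open>s\<close> and \<open>t\<close> are the coordinates of
    \<open>\<eta>\<close> in the real basis 1, \<open>a\<close>.\<close>
  define t where "t = Im \<eta> / Im a"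
  define s where "s = Re \<eta> - t * Re a"
  have "\<bar>t\<bar> \<le> \<rho> / y"
    unfolding t_def y_def abs_divide using \<eta> abs_Im_le_cmod[of \<eta>] by (intro divide_right_mono) auto
  also have "\<dots> \<le> 1 / (2 * (1 + norm a))"
    using \<rho>(3) y by (simp add: field_simps)
  finally have t: "\<bar>t\<bar> \<le> 1 / (2 * (1 + norm a))" .
  have "\<bar>t * Re a\<bar> \<le> 1 / (2 * (1 + norm a)) * norm a"
    unfolding abs_mult using t abs_Re_le_cmod[of a] by (intro mult_mono) auto
  also have "\<dots> \<le> 1/2"
    by (simp add: field_simps add_pos_nonneg)
  finally have ta: "\<bar>t * Re a\<bar> \<le> 1/2" .
  show ?thesis
  proof
    show "\<bar>s\<bar> \<le> 1"
      using ta \<eta> \<rho> abs_Re_le_cmod[of \<eta>] unfolding s_def by linarith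
    show "\<bar>t\<bar> \<le> 1"
      using t by (rule order.trans) (simp add: divide_le_eq add_pos_nonneg)
    have "of_real s + of_real t * a = \<eta>"
      using y by (auto simp: complex_eq_iff s_def t_def y_def)
    then have "v + (of_real s + of_real t * a) * w = Complex q1 q2"
      using w by (simp add: \<eta>_def)
    then show "algebraic (v + (of_real s + of_real t * a) * w)"
      using q algebraic_Complex_Rats by simp
  qed
qed

text \<open>A nondegenerate segment is uncountable, whereas the algebraic numbers are
  countable.\<close>

lemma exists_perturbation_transcendental:
  fixes v w :: complex
  assumes w: "w \<noteq> 0"
  obtains s :: real where "\<bar>s\<bar> \<le> 1" "\<not> algebraic (v + of_real s * w)"
proof -
  have "\<exists>s\<in>{0..1::real}. \<not> algebraic (v + of_real s * w)"
  proof (rule ccontr)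
    assume "\<not> ?thesis"
    then have "(\<lambda>s::real. v + of_real s * w) ` {0..1} \<subseteq> {x. algebraic x}"
      by auto
    then have "countable ((\<lambda>s::real. v + of_real s * w) ` {0..1})"
      using countable_algebraic_complex countable_subset by blast
    moreover have "inj_on (\<lambda>s::real. v + of_real s * w) {0..1}"
      using w by (auto simp: inj_on_def)
    ultimately have "countable {0..1::real}"
      by (rule countable_image_inj_on)
    then show False
      using uncountable_closed_interval[of 0 "1::real"] by simp
  qed
  then obtain s where "0 \<le> s" "s \<le> 1" "\<not> algebraic (v + of_real s * w)"
    by auto
  then show ?thesis
    using that[of s] by auto
qed

lemma exists_perturbation:
  fixes v w a :: complex
  assumes w: "w \<noteq> 0" and real: "a \<in> \<real> \<Longrightarrow> v \<in> \<real> \<and> w \<in> \<real>"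
  obtains s t :: real
  where "\<bar>s\<bar> \<le> 1" "\<bar>t\<bar> \<le> 1" "algebraic (v + (of_real s + of_real t * a) * w) \<longleftrightarrow> b"
proof (cases b)
  case True
  then show ?thesis
    using exists_perturbation_algebraic[of w a v] assms that by metis
next
  case False
  obtain s where "\<bar>s\<bar> \<le> 1" "\<not> algebraic (v + of_real s * w)"
    using exists_perturbation_transcendental[of w v] w by blast
  then show ?thesis
    using that[of s 0] False by simp
qed

section \<open>Real polynomials vanishing at the first points of a sequence\<close>

lemma poly_mult_coeff_Reals:
  fixes p q :: "complex poly"
  assumes "\<And>i. coeff p i \<in> \<real>" "\<And>i. coeff q i \<in> \<real>"
  shows "coeff (p * q) i \<in> \<real>"
  using assms by (auto simp: coeff_mult intro!: sum_in_Reals)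

lemma poly_Reals_of_coeff_Reals:
  fixes p :: "complex poly"
  assumes "\<And>i. coeff p i \<in> \<real>" "z \<in> \<real>"
  shows "poly p z \<in> \<real>"
  using assms by (auto simp: poly_altdef intro!: sum_in_Reals)

text \<open>Normalising at 0 instead of taking monic factors gives constant term 1. Pairing with the
  conjugate keeps the coefficients real; a real \<open>\<alpha> j\<close> simply becomes a double
  zero.\<close>

definition vanishing_poly :: "(nat \<Rightarrow> complex) \<Rightarrow> nat \<Rightarrow> complex poly" where
  "vanishing_poly \<alpha> n = (\<Prod>j<n. [:1, - (1 / \<alpha> j):] * [:1, - (1 / cnj (\<alpha> j)):])"

definition vanishing_bound :: "(nat \<Rightarrow> complex) \<Rightarrow> nat \<Rightarrow> real" where
  "vanishing_bound \<alpha> n = (\<Prod>j<n. (1 + 1 / norm (\<alpha> j))\<^sup>2)"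

lemma coeff_vanishing_poly_Reals: "coeff (vanishing_poly \<alpha> n) i \<in> \<real>"
proof (induction n arbitrary: i)
  case (Suc n)
  have "coeff ([:1, - (1 / a):] * [:1, - (1 / cnj a):]) i \<in> \<real>" for a :: complex and i
    by (auto simp: coeff_pCons Reals_cnj_iff split: nat.splits)
  then show ?case
    using Suc by (simp only: vanishing_poly_def prod.lessThan_Suc poly_mult_coeff_Reals)
qed (auto simp: vanishing_poly_def coeff_1)

lemma coeff_0_vanishing_poly: "coeff (vanishing_poly \<alpha> n) 0 = 1"
  unfolding vanishing_poly_def poly_0_coeff_0[symmetric] poly_prod by simp

lemma poly_vanishing_poly_eq_0:
  assumes "j < n" "\<alpha> j \<noteq> 0"
  shows "poly (vanishing_poly \<alpha> n) (\<alpha> j) = 0"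
  using assms by (auto simp: vanishing_poly_def poly_prod prod_zero_iff intro!: bexI[of _ j])

text \<open>Within the closed upper half plane, \<open>\<alpha> n = cnj (\<alpha> j)\<close> forces
  both points to be real and hence equal.\<close>

lemma poly_vanishing_poly_nonzero:
  assumes inj: "inj \<alpha>" and nz: "\<And>j. \<alpha> j \<noteq> 0" and im: "\<And>j. Im (\<alpha> j) \<ge> 0"
  shows "poly (vanishing_poly \<alpha> n) (\<alpha> n) \<noteq> 0"
proof -
  have "\<alpha> n \<noteq> \<alpha> j \<and> \<alpha> n \<noteq> cnj (\<alpha> j)" if "j < n" for j
  proof -
    have ne: "\<alpha> n \<noteq> \<alpha> j"
      using inj that by (auto simp: inj_eq)
    moreover have "\<alpha> n = \<alpha> j" if "\<alpha> n = cnj (\<alpha> j)"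
      using im[of n] im[of j] that by (auto simp: complex_eq_iff)
    ultimately show ?thesis
      by blast
  qed
  then show ?thesis
    using nz by (auto simp: vanishing_poly_def poly_prod poly_mult simp del: mult_pCons_left mult_pCons_right)
qed

lemma norm_poly_vanishing_poly_le:
  assumes "norm z \<le> 1"
  shows "norm (poly (vanishing_poly \<alpha> n) z) \<le> vanishing_bound \<alpha> n"
  unfolding vanishing_poly_def vanishing_bound_def poly_prod prod_norm[symmetric]
proof (intro prod_mono conjI)
  fix j
  have 1: "norm (1 - z / a) \<le> 1 + 1 / norm a" for a :: complex
  proof -
    have "norm (1 - z / a) \<le> 1 + norm (z / a)"
      using norm_triangle_ineq4[of 1 "z / a"] by simp
    also have "\<dots> \<le> 1 + 1 / norm a"
      using assms by (auto simp: norm_divide intro!: divide_right_mono)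
    finally show ?thesis .
  qed
  show "norm (poly ([:1, - (1 / \<alpha> j):] * [:1, - (1 / cnj (\<alpha> j)):]) z) \<le> (1 + 1 / norm (\<alpha> j))\<^sup>2"
    using mult_mono[OF 1[of "\<alpha> j"] 1[of "cnj (\<alpha> j)"]]
    by (simp add: norm_mult power2_eq_square poly_mult del: mult_pCons_left mult_pCons_right)
qed auto

text \<open>Advance from \<open>n\<close> to \<open>n + 1\<close> only once \<open>k\<close> is
  large enough for \<open>M (n + 1)\<close>. Since \<open>k\<close> is unbounded, no index is kept
  forever, however fast \<open>M\<close> grows.\<close>

lemma exists_slow_sequence:
  fixes M :: "nat \<Rightarrow> real"
  assumes "M 0 \<le> 1"
  obtains s :: "nat \<Rightarrow> nat"
  where "\<And>k. s (Suc k) = s k \<or> s (Suc k) = Suc (s k)" "\<And>k. M (s k) \<le> real k + 1"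
    "\<And>j. \<exists>k. s k = j \<and> s (Suc k) = Suc j"
proof -
  define s where "s = rec_nat 0 (\<lambda>k n. if M (Suc n) \<le> real k + 2 then Suc n else n)"
  have s: "s 0 = 0" "s (Suc k) = (if M (Suc (s k)) \<le> real k + 2 then Suc (s k) else s k)" for k
    by (simp_all add: s_def)
  have step: "\<exists>k. s k = j \<and> s (Suc k) = Suc j" if "s k0 = j" for k0 j
  proof (rule ccontr)
    assume neg: "\<nexists>k. s k = j \<and> s (Suc k) = Suc j"
    have stuck: "s (k0 + i) = j" for i
    proof (induction i)
      case (Suc i)
      then show ?case
        using neg s(2)[of "k0 + i"] by (metis add_Suc_right)
    qed (use that in simp)
    obtain i where i: "M (Suc j) \<le> real i"
      using real_arch_simple by blast
    have "s (Suc (k0 + i)) = Suc j"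
      using i stuck[of i] by (simp add: s(2))
    then show False
      using neg stuck by blast
  qed
  have "\<exists>k. s k = j" for j
  proof (induction j)
    case (Suc j)
    then show ?case
      using step by blast
  qed (use s(1) in blast)
  then have "\<exists>k. s k = j \<and> s (Suc k) = Suc j" for j
    using step by blast
  moreover have "M (s k) \<le> real k + 1" for k
    by (induction k) (use assms in \<open>auto simp: s\<close>)
  ultimately show ?thesis
    using that s(2) by metis
qed

section \<open>Convergence and stepwise construction of the series\<close>

lemma
  fixes r :: "nat \<Rightarrow> complex poly"
  assumes C: "\<And>k z. norm z \<le> 1 \<Longrightarrow> norm (poly (r k) z) \<le> C * (real k + 1)"
  shows summable_power_times_poly: "norm z < 1 \<Longrightarrow> summable (\<lambda>k. z ^ k * poly (r k) z)"
    and holomorphic_power_times_poly: "(\<lambda>z. \<Sum>k. z ^ k * poly (r k) z) holomorphic_on ball 0 1"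
proof -
  \<comment> \<open>The majorant is a multiple of the differentiated geometric series, so the
    Weierstrass test applies on every smaller disc.\<close>
  have bound: "norm (z ^ k * poly (r k) z) \<le> C * (real (Suc k) * \<rho> ^ k)" if "norm z \<le> \<rho>" "\<rho> < 1" for z k \<rho>
  proof -
    have "norm (z ^ k * poly (r k) z) \<le> \<rho> ^ k * (C * (real k + 1))"
      unfolding norm_mult norm_power using that C[of z k] order.trans[OF norm_ge_zero that(1)]
      by (intro mult_mono power_mono) auto
    then show ?thesis
      by (simp add: mult_ac add_ac)
  qed
  have sm: "summable (\<lambda>k. C * (real (Suc k) * \<rho> ^ k))" if "0 \<le> \<rho>" "\<rho> < 1" for \<rho>
    using geometric_deriv_sums[of \<rho>] that by (intro summable_mult) (auto simp: sums_iff)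
  show "summable (\<lambda>k. z ^ k * poly (r k) z)" if "norm z < 1"
    by (rule summable_comparison_test'[OF sm[OF norm_ge_zero that] bound[OF order.refl that]])
  show "(\<lambda>z. \<Sum>k. z ^ k * poly (r k) z) holomorphic_on ball 0 1"
  proof (rule holomorphic_uniform_sequence[where f = "\<lambda>n z. \<Sum>k<n. z ^ k * poly (r k) z"])
    fix x :: complex assume x: "x \<in> ball 0 1"
    define \<rho> where "\<rho> = (1 + norm x) / 2"
    have \<rho>: "norm x < \<rho>" "0 \<le> \<rho>" "\<rho> < 1"
      using x by (auto simp: \<rho>_def)
    have le: "norm z \<le> \<rho>" if "z \<in> cball x (\<rho> - norm x)" for z
      using that norm_triangle_sub[of z x] by (auto simp: dist_norm norm_minus_commute)
    have "uniform_limit (cball x (\<rho> - norm x)) (\<lambda>n z. \<Sum>k<n. z ^ k * poly (r k) z)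
        (\<lambda>z. \<Sum>k. z ^ k * poly (r k) z) sequentially"
      using bound[OF le] sm \<rho> by (intro Weierstrass_m_test) auto
    moreover have "cball x (\<rho> - norm x) \<subseteq> ball 0 1"
      using le \<rho> by fastforce
    ultimately show "\<exists>d>0. cball x d \<subseteq> ball 0 1 \<and> uniform_limit (cball x d)
        (\<lambda>n z. \<Sum>k<n. z ^ k * poly (r k) z) (\<lambda>z. \<Sum>k. z ^ k * poly (r k) z) sequentially"
      using \<rho> by (intro exI[of _ "\<rho> - norm x"]) auto
  qed (auto intro!: holomorphic_intros)
qed

text \<open>The order of choices matters. First \<open>s\<close> and \<open>t\<close> settle the
  value at \<open>\<alpha> n\<close>; then \<open>c\<close> repairs the coefficient. If
  \<open>n' = Suc n\<close>, the second choice does not disturb the first, because its polynomial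
  vanishes at \<open>\<alpha> n\<close>.\<close>

lemma interpolation_step:
  fixes \<alpha> :: "nat \<Rightarrow> complex" and p :: "complex poly"
  assumes inj: "inj \<alpha>" and nz: "\<And>j. \<alpha> j \<noteq> 0" and im: "\<And>j. Im (\<alpha> j) \<ge> 0"
    and p: "\<And>i. coeff p i \<in> \<real>" and n': "n' = n \<or> n' = Suc n"
  obtains r :: "complex poly" where "\<And>i. coeff r i \<in> \<real>"
    "coeff p k + coeff r 0 \<in> \<int>" "coeff p k + coeff r 0 \<noteq> d"
    "\<And>z. norm z \<le> 1 \<Longrightarrow> norm (poly r z) \<le> 2 * vanishing_bound \<alpha> n + 2 * vanishing_bound \<alpha> n'"
    "\<And>j. j < n \<Longrightarrow> poly r (\<alpha> j) = 0"
    "n' = Suc n \<Longrightarrow> algebraic (poly p (\<alpha> n) + \<alpha> n ^ k * poly r (\<alpha> n)) \<longleftrightarrow> b"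
proof -
  let ?Q = "vanishing_poly \<alpha> n" and ?Q' = "vanishing_poly \<alpha> n'"
  define w where "w = \<alpha> n ^ k * poly ?Q (\<alpha> n)"
  have w: "w \<noteq> 0"
    using poly_vanishing_poly_nonzero[OF inj nz im] nz by (simp add: w_def)
  have "poly p (\<alpha> n) \<in> \<real> \<and> w \<in> \<real>" if "\<alpha> n \<in> \<real>"
    using that p by (auto simp: w_def coeff_vanishing_poly_Reals intro!: Reals_mult poly_Reals_of_coeff_Reals)
  then obtain s t :: real where st: "\<bar>s\<bar> \<le> 1" "\<bar>t\<bar> \<le> 1"
      "algebraic (poly p (\<alpha> n) + (of_real s + of_real t * \<alpha> n) * w) \<longleftrightarrow> b"
    by (rule exists_perturbation[OF w])
  define x where "x = Re (coeff p k) + s"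
  have x: "coeff p k + of_real s = of_real x"
    using p[of k] by (simp add: x_def)
  \<comment> \<open>One of two consecutive integers differs from \<open>d\<close>; moving up to the
    second costs at most 2 in \<open>c\<close>.\<close>
  define N where "N = (if of_int \<lceil>x\<rceil> = d then \<lceil>x\<rceil> + 1 else \<lceil>x\<rceil>)"
  define c where "c = real_of_int N - x"
  have c: "\<bar>c\<bar> \<le> 2"
    unfolding c_def N_def by (auto; linarith)
  define r where "r = [:of_real s, of_real t:] * ?Q + smult (of_real c) ?Q'"
  have poly_r: "poly r z = (of_real s + of_real t * z) * poly ?Q z + of_real c * poly ?Q' z" for z
    by (simp add: r_def algebra_simps)
  have "coeff r 0 = of_real s + of_real c"
    using coeff_0_vanishing_poly[of \<alpha>] unfolding poly_0_coeff_0[symmetric] poly_r by simp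
  then have coeff0: "coeff p k + coeff r 0 = of_int N"
    using x by (simp add: c_def flip: add.assoc)
  show ?thesis
  proof
    have "coeff ([:of_real s, of_real t:] * ?Q) i \<in> \<real>" for i
      by (intro poly_mult_coeff_Reals coeff_vanishing_poly_Reals) (auto simp: coeff_pCons split: nat.splits)
    then show "coeff r i \<in> \<real>" for i
      by (auto simp: r_def coeff_vanishing_poly_Reals simp del: mult_pCons_left)
    show "coeff p k + coeff r 0 \<in> \<int>"
      by (simp add: coeff0)
    show "coeff p k + coeff r 0 \<noteq> d"
      unfolding coeff0 by (auto simp: N_def)
    show "norm (poly r z) \<le> 2 * vanishing_bound \<alpha> n + 2 * vanishing_bound \<alpha> n'" if z: "norm z \<le> 1" for z
    proof -
      have "norm (of_real s + of_real t * z) \<le> \<bar>s\<bar> + \<bar>t\<bar> * norm z"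
        using norm_triangle_ineq[of "of_real s" "of_real t * z"] by (simp add: norm_mult)
      also have "\<dots> \<le> 1 + 1 * 1"
        using st z by (intro add_mono mult_mono) auto
      finally have "norm (of_real s + of_real t * z) \<le> 2"
        by simp
      then have "norm ((of_real s + of_real t * z) * poly ?Q z) \<le> 2 * vanishing_bound \<alpha> n"
        unfolding norm_mult using norm_poly_vanishing_poly_le[OF z] by (intro mult_mono) auto
      moreover have "norm (of_real c * poly ?Q' z) \<le> 2 * vanishing_bound \<alpha> n'"
        unfolding norm_mult using norm_poly_vanishing_poly_le[OF z] c by (intro mult_mono) auto
      ultimately show ?thesis
        unfolding poly_r using norm_triangle_mono by blast
    qed
    show "poly r (\<alpha> j) = 0" if "j < n" for j
      using that n' nz by (auto simp: poly_r poly_vanishing_poly_eq_0)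
    show "algebraic (poly p (\<alpha> n) + \<alpha> n ^ k * poly r (\<alpha> n)) \<longleftrightarrow> b" if "n' = Suc n"
      using st(3) that nz by (simp add: poly_r w_def poly_vanishing_poly_eq_0 mult_ac)
  qed
qed

text \<open>Each condition is settled at a finite stage. Later terms carry a higher power of
  \<open>z\<close>, so they leave the coefficient alone, and they vanish at the points already
  treated.\<close>

lemma integer_series_interpolation:
  fixes \<alpha> :: "nat \<Rightarrow> complex" and J :: "nat set" and d :: "nat \<Rightarrow> complex"
  assumes inj: "inj \<alpha>" and nz: "\<And>j. \<alpha> j \<noteq> 0" and im: "\<And>j. Im (\<alpha> j) \<ge> 0"
    and norm: "\<And>j. norm (\<alpha> j) < 1"
  obtains F :: "complex fps" where "fps_conv_radius F \<ge> 1"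
    "\<And>n. fps_nth F n \<in> \<int>" "\<And>n. fps_nth F n \<noteq> d n"
    "\<And>j. algebraic (eval_fps F (\<alpha> j)) \<longleftrightarrow> j \<in> J"
proof -
  let ?M = "vanishing_bound \<alpha>"
  have "?M 0 \<le> 1"
    by (simp add: vanishing_bound_def)
  then obtain s where s: "\<And>k. s (Suc k) = s k \<or> s (Suc k) = Suc (s k)" "\<And>k. ?M (s k) \<le> real k + 1"
      "\<And>j. \<exists>k. s k = j \<and> s (Suc k) = Suc j"
    by (rule exists_slow_sequence) blast
  \<comment> \<open>The conclusions of \<open>interpolation_step\<close> for the indices
    \<open>s k\<close> and \<open>s (Suc k)\<close>, bundled so that \<open>r\<close> can be
    selected by choice.\<close>
  define ok where "ok = (\<lambda>k p r. (\<forall>i. coeff r i \<in> \<real>) \<and>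
      coeff p k + coeff r 0 \<in> \<int> \<and> coeff p k + coeff r 0 \<noteq> d k \<and>
      (\<forall>z. norm z \<le> 1 \<longrightarrow> norm (poly r z) \<le> 2 * ?M (s k) + 2 * ?M (s (Suc k))) \<and>
      (\<forall>j<s k. poly r (\<alpha> j) = 0) \<and>
      (s (Suc k) = Suc (s k) \<longrightarrow>
        (algebraic (poly p (\<alpha> (s k)) + \<alpha> (s k) ^ k * poly r (\<alpha> (s k))) \<longleftrightarrow> s k \<in> J)))"
  have "\<exists>r. ok k p r" if p: "\<And>i. coeff p i \<in> \<real>" for k and p :: "complex poly"
  proof -
    obtain r where "\<And>i. coeff r i \<in> \<real>" "coeff p k + coeff r 0 \<in> \<int>" "coeff p k + coeff r 0 \<noteq> d k"
        "\<And>z. norm z \<le> 1 \<Longrightarrow> norm (poly r z) \<le> 2 * ?M (s k) + 2 * ?M (s (Suc k))"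
        "\<And>j. j < s k \<Longrightarrow> poly r (\<alpha> j) = 0"
        "s (Suc k) = Suc (s k) \<Longrightarrow>
          algebraic (poly p (\<alpha> (s k)) + \<alpha> (s k) ^ k * poly r (\<alpha> (s k))) \<longleftrightarrow> s k \<in> J"
      by (rule interpolation_step[OF inj nz im p s(1)[of k], of k "d k" "s k \<in> J"]) blast
    then show ?thesis
      unfolding ok_def by blast
  qed
  then have R: "ok k p (SOME r. ok k p r)" if "\<And>i. coeff p i \<in> \<real>" for k and p :: "complex poly"
    using that by (blast intro: someI_ex)
  \<comment> \<open>The recursion carries the partial sum, since the next correction depends on
    it.\<close>
  define p where "p = rec_nat 0 (\<lambda>k q. q + monom 1 k * (SOME r. ok k q r))"
  define r where "r k = (SOME r. ok k (p k) r)" for k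
  have p_0: "p 0 = 0" and p_Suc: "p (Suc k) = p k + monom 1 k * r k" for k
    by (simp_all add: p_def r_def)
  have real: "coeff (p k) i \<in> \<real>" for k i
  proof (induction k arbitrary: i)
    case (Suc k)
    then have "ok k (p k) (r k)"
      unfolding r_def by (rule R)
    then show ?case
      using Suc by (auto simp: p_Suc coeff_monom_mult ok_def)
  qed (simp add: p_0)
  have ok: "ok k (p k) (r k)" for k
    unfolding r_def using real by (rule R)
  have bound: "norm (poly (r k) z) \<le> 6 * (real k + 1)" if "norm z \<le> 1" for k z
  proof -
    have "norm (poly (r k) z) \<le> 2 * ?M (s k) + 2 * ?M (s (Suc k))"
      using ok that by (simp add: ok_def)
    also have "\<dots> \<le> 2 * (real k + 1) + 2 * (real (Suc k) + 1)"
      by (intro add_mono mult_left_mono s) auto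
    finally show ?thesis
      by simp
  qed
  \<comment> \<open>Reindexed bound, so that the convergence lemmas also cover the tails
    \<open>g n\<close>.\<close>
  have shifted_bound: "norm (poly (r (i + n)) z) \<le> (6 * (real n + 1)) * (real i + 1)" if "norm z \<le> 1" for i n z
  proof -
    have "norm (poly (r (i + n)) z) \<le> 6 * (real (i + n) + 1)"
      using bound that .
    also have "\<dots> \<le> (6 * (real n + 1)) * (real i + 1)"
      by (simp add: algebra_simps)
    finally show ?thesis .
  qed
  have poly_p: "poly (p k) z = (\<Sum>i<k. z ^ i * poly (r i) z)" for k z
    by (induction k) (simp_all add: p_0 p_Suc poly_monom)
  define f where "f z = (\<Sum>k. z ^ k * poly (r k) z)" for z
  define g where "g n z = (\<Sum>k. z ^ k * poly (r (k + n)) z)" for n z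
  have hol_f: "f holomorphic_on ball 0 1"
    using holomorphic_power_times_poly[OF bound] unfolding f_def .
  have hol_g: "g n holomorphic_on ball 0 1" for n
    using holomorphic_power_times_poly[OF shifted_bound] unfolding g_def .
  \<comment> \<open>With a holomorphic tail factor \<open>g n\<close>, this shows that
    \<open>f\<close> and \<open>p n\<close> have the same Taylor coefficients below degree
    \<open>n\<close>.\<close>
  have split: "f z = poly (p n) z + z ^ n * g n z" if "norm z < 1" for n z
  proof -
    have "f z = (\<Sum>k. z ^ (k + n) * poly (r (k + n)) z) + poly (p n) z"
      unfolding f_def poly_p using that by (intro suminf_split_initial_segment summable_power_times_poly[OF bound])
    also have "(\<Sum>k. z ^ (k + n) * poly (r (k + n)) z) = (\<Sum>k. z ^ n * (z ^ k * poly (r (k + n)) z))"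
      by (simp add: power_add mult_ac)
    also have "\<dots> = z ^ n * g n z"
      unfolding g_def using that by (intro suminf_mult summable_power_times_poly[OF shifted_bound])
    finally show ?thesis
      by simp
  qed
  define F where "F = fps_expansion f 0"
  have F: "f has_fps_expansion F"
    unfolding F_def using hol_f by (intro has_fps_expansion_fps_expansion[of "ball 0 1"]) auto
  have coeff_F: "fps_nth F i = coeff (p n) i" if "i < n" for i n
  proof -
    have "(\<lambda>z. poly (p n) z + z ^ n * g n z) has_fps_expansion fps_of_poly (p n) + fps_X ^ n * fps_expansion (g n) 0"
      using hol_g by (intro fps_expansion_intros has_fps_expansion_fps_expansion[of "ball 0 1"])
        (auto simp: has_fps_expansion_def)
    moreover have "eventually (\<lambda>z. f z = poly (p n) z + z ^ n * g n z) (nhds 0)"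
      using split by (intro eventually_nhds_in_open[of "ball 0 1", THEN eventually_mono]) auto
    ultimately have "f has_fps_expansion fps_of_poly (p n) + fps_X ^ n * fps_expansion (g n) 0"
      by (subst has_fps_expansion_cong) auto
    then have "F = fps_of_poly (p n) + fps_X ^ n * fps_expansion (g n) 0"
      using F fps_expansion_unique_complex by blast
    then show ?thesis
      using that by (simp add: fps_X_power_mult_nth)
  qed
  have coeff_F': "fps_nth F n = coeff (p n) n + coeff (r n) 0" for n
    by (simp add: coeff_F[of n "Suc n"] p_Suc coeff_monom_mult)
  have eval: "eval_fps F z = f z" if "norm z < 1" for z
    using has_fps_expansion_imp_eval_fps_eq[OF F that hol_f] .
  have "mono s"
    using s(1) by (intro mono_iff_le_Suc[THEN iffD2] allI) (metis le_SucI order.refl)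
  show ?thesis
  proof
    have "f holomorphic_on eball 0 1"
      unfolding one_ereal_def eball_ereal by (rule hol_f)
    then show "fps_conv_radius F \<ge> 1"
      by (rule holomorphic_on_imp_fps_conv_radius_ge[OF F])
    show "fps_nth F n \<in> \<int>" "fps_nth F n \<noteq> d n" for n
      using ok[of n] by (simp_all add: coeff_F' ok_def)
    fix j
    obtain k where k: "s k = j" "s (Suc k) = Suc j"
      using s(3) by blast
    \<comment> \<open>Once \<open>s\<close> has passed \<open>j\<close>, all corrections vanish at
      \<open>\<alpha> j\<close>, so the value there is frozen.\<close>
    have "poly (r (i + Suc k)) (\<alpha> j) = 0" for i
    proof -
      have "j < s (i + Suc k)"
        using k(2) monoD[OF \<open>mono s\<close>, of "Suc k" "i + Suc k"] by simp
      then show ?thesis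
        using ok[of "i + Suc k"] by (simp add: ok_def)
    qed
    then have "f (\<alpha> j) = poly (p (Suc k)) (\<alpha> j)"
      using split[OF norm, of j "Suc k"] by (simp add: g_def)
    also have "\<dots> = poly (p k) (\<alpha> j) + \<alpha> j ^ k * poly (r k) (\<alpha> j)"
      by (simp add: p_Suc poly_monom)
    finally show "algebraic (eval_fps F (\<alpha> j)) \<longleftrightarrow> j \<in> J"
      using ok[of k] k by (simp add: eval norm ok_def)
  qed
qed

subsection \<open>Composition with \<open>P\<close>\<close>

lemma eval_fps_cnj:
  assumes "\<And>n. fps_nth F n \<in> \<int>" "norm z < fps_conv_radius F"
  shows "eval_fps F (cnj z) = cnj (eval_fps F z)"
proof -
  have "(\<lambda>n. cnj (fps_nth F n * z ^ n)) sums cnj (eval_fps F z)"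
    using sums_eval_fps[of z F] assms(2) by (simp only: sums_cnj)
  moreover have "cnj (fps_nth F n) = fps_nth F n" for n
    using assms(1)[of n] by (auto elim: Ints_cases)
  ultimately have "(\<lambda>n. fps_nth F n * cnj z ^ n) sums cnj (eval_fps F z)"
    by simp
  then show ?thesis
    by (simp add: eval_fps_def sums_iff)
qed

text \<open>Only nonzero points of the upper half disc need interpolation: the value at 0 is an
  integer and 0 lies in \<open>T\<close>, while the lower half follows by conjugation.
  Uncountability is Cantor's diagonal argument.\<close>

lemma uncountable_integer_series:
  fixes A T :: "complex set"
  assumes A: "countable A" "A \<subseteq> ball 0 1" and T: "\<And>z. z \<in> T \<Longrightarrow> cnj z \<in> T" "0 \<in> T"
  shows "uncountable {F :: complex fps. fps_conv_radius F \<ge> 1 \<and> (\<forall>n. fps_nth F n \<in> \<int>) \<and>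
           (\<forall>z\<in>A. algebraic (eval_fps F z) \<longleftrightarrow> z \<in> T)}" (is "uncountable ?\<F>")
proof
  assume countable: "countable ?\<F>"
  \<comment> \<open>The points \<open>1 / (n + 2)\<close> only serve to make the enumerated set infinite.\<close>
  let ?h = "\<lambda>n::nat. complex_of_real (1 / (real n + 2))"
  define B where "B = {z \<in> A \<union> cnj ` A \<union> range ?h. z \<noteq> 0 \<and> Im z \<ge> 0}"
  have "B \<subseteq> A \<union> cnj ` A \<union> range ?h"
    by (auto simp: B_def)
  then have "countable B"
    by (rule countable_subset) (use A in auto)
  moreover have "infinite B"
  proof
    assume "finite B"
    moreover have "range ?h \<subseteq> B"
      by (auto simp: B_def complex_eq_iff add_nonneg_eq_0_iff)
    ultimately have "finite (range ?h)"
      by (rule rev_finite_subset)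
    moreover have "inj ?h"
      by (auto simp: inj_def simp del: of_real_divide)
    ultimately show False
      using finite_imageD[of ?h UNIV] by simp
  qed
  ultimately have bij: "bij_betw (from_nat_into B) UNIV B"
    by (rule bij_betw_from_nat_into)
  define \<alpha> where "\<alpha> = from_nat_into B"
  have inj: "inj \<alpha>" and range: "range \<alpha> = B"
    using bij by (auto simp: \<alpha>_def bij_betw_def)
  have \<alpha>: "\<alpha> j \<noteq> 0" "Im (\<alpha> j) \<ge> 0" "norm (\<alpha> j) < 1" for j
  proof -
    have "\<alpha> j \<in> B"
      using range by blast
    moreover have "norm (?h n) < 1" for n
      by (simp add: norm_divide flip: of_real_add)
    ultimately show "\<alpha> j \<noteq> 0" "Im (\<alpha> j) \<ge> 0" "norm (\<alpha> j) < 1"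
      using A(2) by (auto simp: B_def subset_iff simp del: of_real_divide)
  qed
  have diagonal: "\<exists>F\<in>?\<F>. \<forall>n. fps_nth F n \<noteq> d n" for d
  proof -
    obtain F where F: "fps_conv_radius F \<ge> 1" "\<And>n. fps_nth F n \<in> \<int>" "\<And>n. fps_nth F n \<noteq> d n"
        "\<And>j. algebraic (eval_fps F (\<alpha> j)) \<longleftrightarrow> j \<in> {j. \<alpha> j \<in> T}"
      by (rule integer_series_interpolation[where d = d and J = "{j. \<alpha> j \<in> T}", OF inj \<alpha>]) blast
    have B: "algebraic (eval_fps F z) \<longleftrightarrow> z \<in> T" if "z \<in> B" for z
      using that F(4) range by auto
    have "algebraic (eval_fps F z) \<longleftrightarrow> z \<in> T" if z: "z \<in> A" for z
    proof -
      have "z = 0 \<or> z \<in> B \<or> cnj z \<in> B"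
        using z by (auto simp: B_def)
      then consider "z = 0" | "z \<in> B" | "cnj z \<in> B"
        by blast
      then show ?thesis
      proof cases
        case 1
        then show ?thesis
          using T(2) F(2)[of 0] by (auto simp: eval_fps_at_0 elim!: Ints_cases)
      next
        case 2
        then show ?thesis
          by (rule B)
      next
        case 3
        have "ereal (norm z) < 1"
          using A(2) z by auto
        then have "eval_fps F (cnj z) = cnj (eval_fps F z)"
          using F(1) by (intro eval_fps_cnj F(2)) (rule less_le_trans)
        moreover have "cnj z \<in> T \<longleftrightarrow> z \<in> T"
          using T(1)[of z] T(1)[of "cnj z"] by auto
        ultimately show ?thesis
          using B[OF 3] by simp
      qed
    qed
    then show ?thesis
      using F(1-3) by blast
  qed
  then have "?\<F> \<noteq> {}"
    by blast
  define e where "e = from_nat_into ?\<F>"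
  have e: "range e = ?\<F>"
    unfolding e_def using \<open>?\<F> \<noteq> {}\<close> countable by (rule range_from_nat_into)
  \<comment> \<open>The avoided sequence is the diagonal of the supposed enumeration.\<close>
  from diagonal[of "\<lambda>n. fps_nth (e n) n"]
  obtain F where F: "F \<in> ?\<F>" "\<forall>n. fps_nth F n \<noteq> fps_nth (e n) n" ..
  from F(1) obtain n where "F = e n"
    unfolding e[symmetric] by (rule imageE)
  then show False
    using F(2)[rule_format, of n] by simp
qed

text \<open>The relation holds on a neighbourhood of 0, so uniqueness of expansions turns it into an
  identity of formal power series.\<close>

lemma algebraic_function_imp_algebraic_fps:
  assumes alg: "algebraic_function_on U f" and U: "open U" "0 \<in> U" and f: "f has_fps_expansion \<phi>"
  shows "\<exists>Q :: complex poly poly. Q \<noteq> 0 \<and> poly (map_poly fps_of_poly Q) \<phi> = 0"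
proof -
  obtain Q :: "complex poly poly" where Q: "Q \<noteq> 0" "\<And>z. z \<in> U \<Longrightarrow> poly (poly Q [:f z:]) z = 0"
    using alg by (auto simp: algebraic_function_on_def)
  have "(\<lambda>z. \<Sum>i\<le>degree Q. poly (coeff Q i) z * f z ^ i) has_fps_expansion
      (\<Sum>i\<le>degree Q. fps_of_poly (coeff Q i) * \<phi> ^ i)"
    by (intro fps_expansion_intros f) (auto simp: has_fps_expansion_def)
  moreover have "eventually (\<lambda>z. z \<in> U) (nhds 0)"
    using U by (rule eventually_nhds_in_open)
  then have "eventually (\<lambda>z. (\<Sum>i\<le>degree Q. poly (coeff Q i) z * f z ^ i) = 0) (nhds 0)"
  proof eventually_elim
    case (elim z)
    then show ?case
      using Q(2)[of z] by (simp add: poly_altdef[of Q] poly_sum poly_mult poly_power)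
  qed
  then have "(\<lambda>z. \<Sum>i\<le>degree Q. poly (coeff Q i) z * f z ^ i) has_fps_expansion 0"
    by (simp add: has_fps_expansion_0_iff)
  ultimately have "(\<Sum>i\<le>degree Q. fps_of_poly (coeff Q i) * \<phi> ^ i) = 0"
    by (rule fps_expansion_unique_complex)
  moreover have "degree (map_poly fps_of_poly Q) = degree Q"
    using Q(1) fps_of_poly_eq_iff[of "lead_coeff Q" 0] by (intro degree_map_poly) simp
  ultimately have "poly (map_poly fps_of_poly Q) \<phi> = 0"
    by (simp add: poly_altdef coeff_map_poly)
  with Q(1) show ?thesis
    by blast
qed

section \<open>Density of the vanishing coefficients\<close>

lemma lower_density_ge_of_non_multiples:
  assumes "g > 0" "\<And>n. \<not> g dvd n \<Longrightarrow> n \<in> Z"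
  shows "lower_density Z \<ge> ereal (1 - 1 / real g)"
  unfolding lower_density_def
proof (rule Liminf_bounded)
  show "\<forall>\<^sub>F n in sequentially. ereal (1 - 1 / real g) \<le> ereal (real (card (Z \<inter> {0..n})) / real n)"
    using eventually_gt_at_top[of 0]
  proof eventually_elim
    case (elim n)
    let ?D = "(\<lambda>i. g * i) ` {0..n div g}"
    have "{0..n} - ?D \<subseteq> Z \<inter> {0..n}"
    proof
      fix k assume k: "k \<in> {0..n} - ?D"
      have "\<not> g dvd k"
      proof
        assume "g dvd k"
        then have "k = g * (k div g)"
          by simp
        moreover have "k div g \<le> n div g"
          using k by (simp add: div_le_mono)
        ultimately show False
          using k by auto
      qed
      then show "k \<in> Z \<inter> {0..n}"
        using k assms(2) by blast
    qed
    then have "card ({0..n} - ?D) \<le> card (Z \<inter> {0..n})"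
      by (intro card_mono) auto
    moreover have "card {0..n} - card ?D \<le> card ({0..n} - ?D)"
      by (intro diff_card_le_card_Diff) auto
    moreover have "card ?D \<le> Suc (n div g)"
      using card_image_le[of "{0..n div g}" "\<lambda>i. g * i"] by simp
    \<comment> \<open>The extra multiple 0 is offset by \<open>{0..n}\<close> having
      \<open>n + 1\<close> elements.\<close>
    ultimately have "n \<le> card (Z \<inter> {0..n}) + n div g"
      by simp
    then have "real n \<le> real (card (Z \<inter> {0..n})) + real (n div g)"
      by (metis of_nat_add of_nat_le_iff)
    also have "real (n div g) \<le> real n / real g"
      by (rule of_nat_div_le_of_nat)
    finally have "real n * (1 - 1 / real g) \<le> real (card (Z \<inter> {0..n}))"
      by (simp add: algebra_simps)
    then show ?case
      using elim by (simp add: le_divide_eq mult.commute)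
  qed
qed

text \<open>If \<open>g\<close> does not divide \<open>n = j + (n - j)\<close>, it fails to divide
  one of the summands, so each term of the Cauchy product vanishes.\<close>

lemma fps_power_support_multiples:
  fixes G :: "complex fps"
  assumes "\<And>n. \<not> g dvd n \<Longrightarrow> fps_nth G n = 0" "\<not> g dvd n"
  shows "fps_nth (G ^ i) n = 0"
  using assms(2)
proof (induction i arbitrary: n)
  case (Suc i)
  have "fps_nth G j * fps_nth (G ^ i) (n - j) = 0" if "j \<le> n" for j
  proof (cases "g dvd j")
    case True
    then have "\<not> g dvd n - j"
      using Suc.prems that dvd_diffD by blast
    then show ?thesis
      using Suc.IH by simp
  qed (simp add: assms(1))
  then show ?case
    by (auto simp only: power_Suc fps_mult_nth atLeastAtMost_iff intro!: sum.neutral)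
next
  case 0
  then show ?case
    by (cases "n = 0") auto
qed

section \<open>Transfer from integer series to functions on \<open>Omega P\<close>\<close>

theorem theorem1p7:
  fixes P :: "int poly" and k :: nat and m :: "nat \<Rightarrow> nat" and a :: "nat \<Rightarrow> int"
    and S :: "complex set"
  assumes "P = (\<Sum>i=1..k. monom (a (m i)) (m i))"
    and "\<And>i. i \<in> {1..k} \<Longrightarrow> m i > 0"
    and "\<And>i. i \<in> {1..k} \<Longrightarrow> a (m i) \<noteq> 0"
    and "degree P > 0"
    and "S \<subseteq> Omega P \<inter> {z. algebraic z}"
    and "\<And>\<alpha>. \<alpha> \<in> S \<Longrightarrow> cnj \<alpha> \<in> S"
    and "0 \<in> S"
    and "\<And>\<alpha> z. \<alpha> \<in> S \<Longrightarrow> poly (cpoly_of_int P - [:poly (cpoly_of_int P) \<alpha>:]) z = 0 \<Longrightarrow> z \<in> S"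
  shows "uncountable {\<psi> \<in> extensional (Omega P).
           \<psi> analytic_on Omega P \<and>
           transcendental_function_on (Omega P) \<psi> \<and>
           (\<forall>n. taylor_coeff \<psi> n \<in> \<int>) \<and>
           exceptional_set (Omega P) \<psi> = S \<and>
           lower_density (zero_coeffs \<psi>) \<ge> ereal (1 - 1 / real (Gcd (m ` {1..k})))}"
    (is "uncountable ?\<Psi>")
proof -
  define g where "g = Gcd (m ` {1..k})"
  define p where "p = cpoly_of_int P"
  define G where "G = fps_of_poly p"
  define \<Omega> where "\<Omega> = Omega P"
  have \<Omega>: "z \<in> \<Omega> \<longleftrightarrow> norm (poly p z) < 1 \<and> norm z < 1" for z
    by (auto simp: \<Omega>_def Omega_def p_def)
  have "\<Omega> = poly p -` ball 0 1 \<inter> ball 0 1"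
    by (simp add: \<Omega>_def Omega_def p_def)
  then have "open \<Omega>"
    by (auto intro!: open_Int open_vimage continuous_intros)
  have "0 \<in> \<Omega>"
    using assms(5,7) by (auto simp: \<Omega>_def)

  have "k \<ge> 1"
    using assms(1,4) by (cases k) auto
  then have "m 1 \<in> m ` {1..k}" "m 1 > 0"
    using assms(2) by auto
  then have "g > 0"
    unfolding g_def by (metis Gcd_0_iff gr0I insert_iff neq0_conv singletonD subset_iff)
  have coeff_P: "coeff P n = (\<Sum>i=1..k. if m i = n then a (m i) else 0)" for n
    by (simp add: assms(1) coeff_sum)
  have "coeff P 0 = 0"
    using assms(2) by (force simp: coeff_P intro!: sum.neutral)
  then have G_0: "fps_nth G 0 = 0"
    by (simp add: G_def p_def coeff_map_poly)
  have "P \<noteq> 0"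
    using assms(4) by auto
  then have "G \<noteq> 0"
    by (auto simp: G_def p_def poly_eq_iff fps_eq_iff coeff_map_poly)
  have G_Ints: "fps_nth G n \<in> \<int>" for n
    by (simp add: G_def p_def coeff_map_poly)
  have G_support: "fps_nth G n = 0" if "\<not> g dvd n" for n
  proof -
    have "m i \<noteq> n" if "i \<in> {1..k}" for i
      using that \<open>\<not> g dvd n\<close> unfolding g_def by (metis Gcd_dvd imageI)
    then have "coeff P n = 0"
      by (auto simp: coeff_P intro!: sum.neutral)
    then show ?thesis
      by (simp add: G_def p_def coeff_map_poly)
  qed
  have poly_p_cnj: "poly p (cnj z) = cnj (poly p z)" for z
    by (rule poly_cnj_real[symmetric]) (simp add: p_def coeff_map_poly)

  \<comment> \<open>\<open>A\<close> collects the values at which \<open>F\<close> must be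
    controlled, \<open>T\<close> those where the result is to be algebraic.\<close>
  define A where "A = poly p ` (\<Omega> \<inter> {z. algebraic z})"
  define T where "T = poly p ` S"
  define \<F> where "\<F> = {F :: complex fps. fps_conv_radius F \<ge> 1 \<and> (\<forall>n. fps_nth F n \<in> \<int>) \<and>
      (\<forall>z\<in>A. algebraic (eval_fps F z) \<longleftrightarrow> z \<in> T)}"
  have "uncountable \<F>"
    unfolding \<F>_def
  proof (rule uncountable_integer_series)
    show "countable A"
      unfolding A_def using countable_algebraic_complex by (intro countable_image countable_Int2)
    show "A \<subseteq> ball 0 1"
      by (auto simp: A_def \<Omega>)
    show "cnj z \<in> T" if "z \<in> T" for z
      using that assms(6) by (auto simp: T_def simp flip: poly_p_cnj)
    have "poly p 0 = 0"
      using G_0 by (simp add: G_def poly_0_coeff_0)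
    then show "0 \<in> T"
      using assms(7) by (force simp: T_def)
  qed

  \<comment> \<open>Restricting makes the functions extensional, so they are counted by their values
    on \<open>\<Omega>\<close> only.\<close>
  define \<psi> where "\<psi> F = restrict (eval_fps F \<circ> poly p) \<Omega>" for F :: "complex fps"
  have expansion: "\<psi> F has_fps_expansion (F oo G)" if "F \<in> \<F>" for F
  proof -
    have "fps_conv_radius F > 0"
      using that by (auto simp: \<F>_def intro: less_le_trans[of 0 1])
    then have "(eval_fps F \<circ> poly p) has_fps_expansion (F oo G)"
      by (intro has_fps_expansion_compose eval_fps_has_fps_expansion G_0)
        (auto simp: has_fps_expansion_def G_def)
    moreover have "eventually (\<lambda>z. \<psi> F z = (eval_fps F \<circ> poly p) z) (nhds 0)"
      using eventually_nhds_in_open[OF \<open>open \<Omega>\<close> \<open>0 \<in> \<Omega>\<close>] by eventually_elim (simp add: \<psi>_def)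
    ultimately show ?thesis
      by (subst has_fps_expansion_cong) auto
  qed
  have taylor: "taylor_coeff (\<psi> F) n = fps_nth (F oo G) n" if "F \<in> \<F>" for F n
    unfolding taylor_coeff_def fps_expansion_eqI[OF expansion[OF that]] ..
  have compose_Ints: "fps_nth (F oo G) n \<in> \<int>" if "F \<in> \<F>" for F n
    using that fps_power_coeff_Ints[OF G_Ints]
    by (auto simp: fps_compose_nth \<F>_def intro!: Ints_sum Ints_mult)
  \<comment> \<open>As \<open>G\<close> is nonzero without constant term, composition with it loses
    nothing; countability of the algebraic compositions thus passes back to the series
    \<open>F\<close>.\<close>
  have inj: "inj_on (\<lambda>F. F oo G) \<F>"
  proof (rule inj_onI)
    fix F F' assume "F oo G = F' oo G"
    then have "(F - F') oo G = 0"
      by (simp add: fps_compose_sub_distrib)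
    then show "F = F'"
      using fps_compose_eq_0_iff[OF G_0, of "F - F'"] \<open>G \<noteq> 0\<close> by auto
  qed

  define \<A> where "\<A> = {\<phi> :: complex fps. (\<forall>n. fps_nth \<phi> n \<in> \<int>) \<and>
     (\<exists>Q :: complex poly poly. Q \<noteq> 0 \<and> poly (map_poly fps_of_poly Q) \<phi> = 0)}"
  define \<F>' where "\<F>' = {F \<in> \<F>. F oo G \<notin> \<A>}"
  have "countable ((\<lambda>F. F oo G) ` (\<F> - \<F>'))"
  proof (rule countable_subset)
    show "(\<lambda>F. F oo G) ` (\<F> - \<F>') \<subseteq> \<A>"
      by (auto simp: \<F>'_def)
    show "countable \<A>"
      unfolding \<A>_def by (rule countable_algebraic_Ints_fps)
  qed
  then have "countable (\<F> - \<F>')"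
    by (rule countable_image_inj_on) (rule inj_on_subset[OF inj Diff_subset])
  moreover have "\<F>' \<subseteq> \<F>"
    by (auto simp: \<F>'_def)
  then have "\<F> = \<F>' \<union> (\<F> - \<F>')"
    by blast
  ultimately have uncountable: "uncountable \<F>'"
    using \<open>uncountable \<F>\<close> by (metis countable_Un)

  have "\<psi> F \<in> ?\<Psi>" if "F \<in> \<F>'" for F
  proof -
    have F: "F \<in> \<F>" "F oo G \<notin> \<A>"
      using that by (auto simp: \<F>'_def)
    have radius: "fps_conv_radius F \<ge> 1"
      using F by (simp add: \<F>_def)
    have "eval_fps F holomorphic_on ball 0 1"
    proof (rule holomorphic_on_eval_fps)
      show "ball 0 1 \<subseteq> eball 0 (fps_conv_radius F)"
        using radius by (intro ball_eball_mono) (simp add: one_ereal_def)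
    qed
    moreover have "poly p holomorphic_on \<Omega>" "poly p ` \<Omega> \<subseteq> ball 0 1"
      by (auto simp: \<Omega> intro!: holomorphic_intros)
    ultimately have "(eval_fps F \<circ> poly p) holomorphic_on \<Omega>"
      using holomorphic_on_compose_gen by blast
    then have "\<psi> F holomorphic_on \<Omega>"
      by (rule holomorphic_transform) (simp add: \<psi>_def)
    then have "\<psi> F analytic_on \<Omega>"
      using \<open>open \<Omega>\<close> by (simp add: analytic_on_open)
    moreover have "transcendental_function_on \<Omega> (\<psi> F)"
      unfolding transcendental_function_on_def
    proof
      assume "algebraic_function_on \<Omega> (\<psi> F)"
      then have "F oo G \<in> \<A>"
        using algebraic_function_imp_algebraic_fps[OF _ \<open>open \<Omega>\<close> \<open>0 \<in> \<Omega>\<close> expansion[OF F(1)]]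
          compose_Ints[OF F(1)] unfolding \<A>_def by blast
      with F(2) show False ..
    qed
    moreover have "exceptional_set \<Omega> (\<psi> F) = S"
    proof -
      have "algebraic (\<psi> F z) \<longleftrightarrow> z \<in> S" if z: "z \<in> \<Omega>" "algebraic z" for z
      proof -
        have "algebraic (\<psi> F z) \<longleftrightarrow> poly p z \<in> T"
          using z F(1) by (auto simp: \<psi>_def \<F>_def A_def)
        \<comment> \<open>Here the root condition enters: if
          \<open>poly p z = poly p \<alpha>\<close> with \<open>\<alpha>\<close> in
          \<open>S\<close>, then \<open>z\<close> is a root of
          \<open>P - P(\<alpha>)\<close>.\<close>
        also have "\<dots> \<longleftrightarrow> z \<in> S"
          using assms(8)[of _ z] by (auto simp: T_def p_def)
        finally show ?thesis .
      qed
      then show ?thesis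
        using assms(5) by (auto simp: exceptional_set_def \<Omega>_def)
    qed
    moreover have "lower_density (zero_coeffs (\<psi> F)) \<ge> ereal (1 - 1 / real g)"
    proof (rule lower_density_ge_of_non_multiples[OF \<open>g > 0\<close>])
      show "n \<in> zero_coeffs (\<psi> F)" if "\<not> g dvd n" for n
        using fps_power_support_multiples[OF G_support that]
        by (simp add: zero_coeffs_def taylor[OF F(1)] fps_compose_nth)
    qed
    moreover have "\<psi> F \<in> extensional \<Omega>"
      by (simp add: \<psi>_def)
    moreover have "\<forall>n. taylor_coeff (\<psi> F) n \<in> \<int>"
      using compose_Ints[OF F(1)] by (simp add: taylor[OF F(1)])
    ultimately show ?thesis
      unfolding \<Omega>_def g_def by blast
  qed
  then have "\<psi> ` \<F>' \<subseteq> ?\<Psi>"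
    by blast
  \<comment> \<open>\<open>\<psi> F\<close> determines its expansion \<open>F oo G\<close>, and this
    determines \<open>F\<close>.\<close>
  moreover have "inj_on \<psi> \<F>'"
  proof (rule inj_onI)
    fix F F' assume FF': "F \<in> \<F>'" "F' \<in> \<F>'" "\<psi> F = \<psi> F'"
    then have "F \<in> \<F>" "F' \<in> \<F>"
      by (auto simp: \<F>'_def)
    then show "F = F'"
      using expansion FF'(3) fps_expansion_unique_complex inj by (metis inj_onD)
  qed
  ultimately show ?thesis
    using uncountable countable_subset countable_image_inj_on by blast
qed

end
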